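(* Let $(G=N\rtimes H,d)$ be a metric group such that $\pi_N$ is $k$-Lipschitz at $1$, i.e. $d(1,\pi_N(g))\le k\,d(1,g)$ for all $g\in G$. Let $\phi:N\to H$ be a map, $m\in N$ and $p=m\phi(m)$. Then the statement (1) there is $L>0$ such that $\phi$ is intrinsically $L$-Lipschitz at the point $m$ with respect to $d$ is equivalent to each one of the following: (a) there is $L>0$ such that $d(1,\phi_{p^{-1}}(n))\le L\,d(1,n)$ for all $n\in N$; (b) there is $L>0$ such that $d(\phi(m),\phi(n))\le L\,d(1,\pi_N(p^{-1}q))$ for all $n\in N$, where $q=n\phi(n)\in\Gamma_\phi$; (c) there is $L>0$ such that $d(\phi(\pi_N(p)),\phi(\pi_N(pn)))\le L\,d(1,n)$ for all $n\in N$; (d) there is $\tilde L>0$ such that $d(1,q)\le\tilde L\,d(1,\pi_N(q))$ for all $q\in\Gamma_{\phi_{p^{-1}}}$; (e) there is $\bar L>0$ such that $d(p,q)\le\bar L\,d(1,\pi_N(p^{-1}q))$ for all $q\in\Gamma_\phi$.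
   Context: A metric group is a topological group $G$ with a left-invariant distance $d$ inducing its topology. $G=N\rtimes H$ means that $N,H$ are subgroups of $G$, $N$ is normal, $N\cap H=\{1\}$ and $G=NH$; every $g\in G$ is written uniquely as $g=\pi_N(g)\pi_H(g)$ with $\pi_N(g)\in N$, $\pi_H(g)\in H$. For $\phi:N\to H$ the intrinsic graph is $\Gamma_\phi=\{n\phi(n):n\in N\}$. The map $\phi$ is intrinsically $L$-Lipschitz at $m\in N$ if, with $p=m\phi(m)$, $d(1,\pi_H(p^{-1}x))\le L\,d(1,\pi_N(p^{-1}x))$ for all $x\in\Gamma_\phi$. For $q\in G$ the translated function $\phi_q:N\to H$ is $\phi_q(n)=(\pi_H(q^{-1}n))^{-1}\phi(\pi_N(q^{-1}n))$. *)

theory Defs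
  imports "HOL-Analysis.Analysis" "HOL-Algebra.Coset"
begin

locale topological_group = group G for G (structure) +
  fixes T :: "'a topology"
  assumes topspace_eq: "topspace T = carrier G"
    and continuous_mult: "continuous_map (prod_topology T T) T (\<lambda>(x, y). x \<otimes> y)"
    and continuous_inv: "continuous_map T T (\<lambda>x. inv x)"

locale metric_group = topological_group G T + Metric_space "carrier G" d
  for G (structure) and T and d +
  assumes left_invariant:
      "\<lbrakk>g \<in> carrier G; x \<in> carrier G; y \<in> carrier G\<rbrakk> \<Longrightarrow> d (g \<otimes> x) (g \<otimes> y) = d x y"
    and induces_topology: "Metric_space.mtopology (carrier G) d = T"

locale internal_semidirect_product = normal N G + complement: subgroup H G
  for N and H and G (structure) +
  assumes trivial_Int: "N \<inter> H = {\<one>}"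
    and product: "N <#> H = carrier G"

text \<open>The unique factors of an element \<open>g = n \<otimes> h\<close> with \<open>n \<in> N\<close> and \<open>h \<in> H\<close>.\<close>

definition proj_N :: "('a, 'b) monoid_scheme \<Rightarrow> 'a set \<Rightarrow> 'a set \<Rightarrow> 'a \<Rightarrow> 'a" where
  "proj_N G N H g = (THE n. n \<in> N \<and> (\<exists>h\<in>H. g = n \<otimes>\<^bsub>G\<^esub> h))"

definition proj_H :: "('a, 'b) monoid_scheme \<Rightarrow> 'a set \<Rightarrow> 'a set \<Rightarrow> 'a \<Rightarrow> 'a" where
  "proj_H G N H g = (THE h. h \<in> H \<and> (\<exists>n\<in>N. g = n \<otimes>\<^bsub>G\<^esub> h))"

definition intrinsic_graph :: "('a, 'b) monoid_scheme \<Rightarrow> 'a set \<Rightarrow> ('a \<Rightarrow> 'a) \<Rightarrow> 'a set" where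
  "intrinsic_graph G N \<phi> = {n \<otimes>\<^bsub>G\<^esub> \<phi> n | n. n \<in> N}"

definition intrinsically_Lipschitz_at ::
  "('a, 'b) monoid_scheme \<Rightarrow> 'a set \<Rightarrow> 'a set \<Rightarrow> ('a \<Rightarrow> 'a \<Rightarrow> real) \<Rightarrow> real \<Rightarrow> ('a \<Rightarrow> 'a) \<Rightarrow> 'a \<Rightarrow> bool"
where
  "intrinsically_Lipschitz_at G N H d L \<phi> m \<longleftrightarrow>
    (let p = m \<otimes>\<^bsub>G\<^esub> \<phi> m in
      \<forall>x \<in> intrinsic_graph G N \<phi>.
        d \<one>\<^bsub>G\<^esub> (proj_H G N H (inv\<^bsub>G\<^esub> p \<otimes>\<^bsub>G\<^esub> x))
          \<le> L * d \<one>\<^bsub>G\<^esub> (proj_N G N H (inv\<^bsub>G\<^esub> p \<otimes>\<^bsub>G\<^esub> x)))"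

definition translated ::
  "('a, 'b) monoid_scheme \<Rightarrow> 'a set \<Rightarrow> 'a set \<Rightarrow> ('a \<Rightarrow> 'a) \<Rightarrow> 'a \<Rightarrow> 'a \<Rightarrow> 'a"
where
  "translated G N H \<phi> q n =
    inv\<^bsub>G\<^esub> (proj_H G N H (inv\<^bsub>G\<^esub> q \<otimes>\<^bsub>G\<^esub> n))
      \<otimes>\<^bsub>G\<^esub> \<phi> (proj_N G N H (inv\<^bsub>G\<^esub> q \<otimes>\<^bsub>G\<^esub> n))"

end

theory Submission
  imports Defs
begin

text \<open>
  Left translation by \<open>q\<close> carries the graph of \<open>\<phi>\<close> onto the graph of the translated function
  (\<open>intrinsic_graph_translated\<close>), so that by left invariance every condition at
  \<open>p = m \<otimes> \<phi> m\<close> becomes one at \<open>\<one>\<close> on the graph of \<open>\<psi> = translated G N H \<phi> (inv p)\<close>.  A point of this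
  graph has the form \<open>n \<otimes> \<psi> n\<close> with projections \<open>n\<close> and \<open>\<psi> n\<close>, hence the intrinsic Lipschitz
  condition is the cone condition \<open>d \<one> (\<psi> n) \<le> L * d \<one> n\<close>.  Since \<open>N\<close> is normal, the projection to \<open>H\<close> is
  a homomorphism (\<open>proj_H_mult\<close>), which identifies \<open>d \<one> (\<psi> n)\<close> and \<open>d \<one> (proj_H G N H (inv p \<otimes> x))\<close> with
  distances between values of \<open>\<phi>\<close>.

  The conditions on \<open>d \<one> q\<close> and \<open>d p q\<close> measure the whole point \<open>n \<otimes> h\<close> in place of its factor \<open>h\<close>.
  By the triangle inequality and left invariance \<open>d \<one> (n \<otimes> h)\<close> and \<open>d \<one> h\<close> differ by at most \<open>d \<one> n\<close>
  (\<open>dist_one_mult\<close>, \<open>dist_one_right_factor\<close>), so there the constant changes from \<open>L\<close> to \<open>L + 1\<close>; in all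
  other equivalences it stays the same.
\<close>

context internal_semidirect_product
begin

lemma carrier_of_N: "n \<in> N \<Longrightarrow> n \<in> carrier G"
  using subset by blast

lemma carrier_of_H: "h \<in> H \<Longrightarrow> h \<in> carrier G"
  using complement.subset by blast

lemma factorization_unique:
  assumes "n \<in> N" "h \<in> H" "n' \<in> N" "h' \<in> H" and eq: "n \<otimes> h = n' \<otimes> h'"
  shows "n = n'" and "h = h'"
proof -
  have nc: "n \<in> carrier G" "n' \<in> carrier G" and hc: "h \<in> carrier G" "h' \<in> carrier G"
    using assms by (auto intro: carrier_of_N carrier_of_H)
  have "inv n' \<otimes> n = inv n' \<otimes> (n \<otimes> h) \<otimes> inv h"
    using nc hc by (simp add: m_assoc)
  also have "\<dots> = h' \<otimes> inv h"
    unfolding eq using nc hc by (simp add: m_assoc[symmetric])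
  finally have "inv n' \<otimes> n = h' \<otimes> inv h" .
  moreover have "inv n' \<otimes> n \<in> N" "h' \<otimes> inv h \<in> H"
    using assms by auto
  ultimately have "inv n' \<otimes> n = \<one>"
    using trivial_Int by auto
  then show "n = n'"
    using nc by (metis inv_equality inv_inv inv_closed)
  then show "h = h'"
    using eq nc hc by simp
qed

lemma proj_N_factors: "n \<in> N \<Longrightarrow> h \<in> H \<Longrightarrow> proj_N G N H (n \<otimes> h) = n"
  unfolding proj_N_def by (rule the_equality) (auto dest: factorization_unique)

lemma proj_H_factors: "n \<in> N \<Longrightarrow> h \<in> H \<Longrightarrow> proj_H G N H (n \<otimes> h) = h"
  unfolding proj_H_def by (rule the_equality) (auto dest: factorization_unique)

lemma factorsE:
  assumes "g \<in> carrier G"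
  obtains n h where "n \<in> N" "h \<in> H" "g = n \<otimes> h"
  using assms product unfolding set_mult_def by blast

lemma proj_closed:
  assumes "g \<in> carrier G"
  shows "proj_N G N H g \<in> N" and "proj_H G N H g \<in> H"
  using assms by (auto elim!: factorsE simp: proj_N_factors proj_H_factors)

lemma proj_N_proj_H: "g \<in> carrier G \<Longrightarrow> proj_N G N H g \<otimes> proj_H G N H g = g"
  by (auto elim!: factorsE simp: proj_N_factors proj_H_factors)

lemma proj_of_N: "n \<in> N \<Longrightarrow> proj_N G N H n = n" "n \<in> N \<Longrightarrow> proj_H G N H n = \<one>"
  using proj_N_factors[of n \<one>] proj_H_factors[of n \<one>] by (auto simp: carrier_of_N)

lemma proj_H_of_H: "h \<in> H \<Longrightarrow> proj_H G N H h = h"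
  using proj_H_factors[of \<one> h] by (auto simp: carrier_of_H)

text \<open>
  Moving the \<open>N\<close>-factor of \<open>y\<close> past the \<open>H\<close>-factor of \<open>x\<close> conjugates it, and the conjugate stays in
  the normal subgroup \<open>N\<close>.
\<close>

lemma proj_H_mult:
  assumes "x \<in> carrier G" "y \<in> carrier G"
  shows "proj_H G N H (x \<otimes> y) = proj_H G N H x \<otimes> proj_H G N H y"
proof -
  obtain n h where x: "n \<in> N" "h \<in> H" "x = n \<otimes> h" using factorsE assms(1) by metis
  obtain n' h' where y: "n' \<in> N" "h' \<in> H" "y = n' \<otimes> h'" using factorsE assms(2) by metis
  have c: "n \<in> carrier G" "h \<in> carrier G" "n' \<in> carrier G" "h' \<in> carrier G"
    using x y by (auto intro: carrier_of_N carrier_of_H)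
  have "inv h \<otimes> (h \<otimes> h') = h'"
    using c by (simp add: m_assoc[symmetric])
  then have "x \<otimes> y = (n \<otimes> (h \<otimes> n' \<otimes> inv h)) \<otimes> (h \<otimes> h')"
    using x(3) y(3) c by (simp add: m_assoc)
  moreover have "n \<otimes> (h \<otimes> n' \<otimes> inv h) \<in> N"
    using x y c by (simp add: inv_op_closed2)
  ultimately show ?thesis
    using x y by (simp add: proj_H_factors)
qed

lemma proj_H_inv:
  assumes "x \<in> carrier G"
  shows "proj_H G N H (inv x) = inv (proj_H G N H x)"
proof -
  have "proj_H G N H (inv x) \<otimes> proj_H G N H x = \<one>"
    using assms proj_H_mult[of "inv x" x] by (simp add: proj_of_N)
  then show ?thesis
    using assms proj_closed(2) by (metis carrier_of_H inv_closed inv_equality)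
qed

lemma translated_closed:
  assumes "\<phi> \<in> N \<rightarrow> H" "q \<in> carrier G" "n \<in> N"
  shows "translated G N H \<phi> q n \<in> H"
  using assms proj_closed[of "inv q \<otimes> n"]
  by (auto simp: translated_def carrier_of_N)

text \<open>
  The function \<open>translated G N H \<phi> q\<close> is designed for this identity: with
  \<open>y = proj_N G N H (inv q \<otimes> n)\<close>, the inverse \<open>H\<close>-factor cancels the \<open>H\<close>-factor of \<open>inv q \<otimes> n\<close> and
  leaves \<open>q \<otimes> y\<close>.
\<close>

lemma translated_graph_point:
  assumes "\<phi> \<in> N \<rightarrow> H" "q \<in> carrier G" "n \<in> N"
  defines "y \<equiv> proj_N G N H (inv q \<otimes> n)"
  shows "n \<otimes> translated G N H \<phi> q n = q \<otimes> (y \<otimes> \<phi> y)"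
proof -
  define h where "h = proj_H G N H (inv q \<otimes> n)"
  have nc: "n \<in> carrier G" using assms by (simp add: carrier_of_N)
  have yh: "y \<in> N" "h \<in> H" "y \<otimes> h = inv q \<otimes> n"
    unfolding y_def h_def using assms nc by (auto simp: proj_closed proj_N_proj_H)
  have c: "y \<in> carrier G" "h \<in> carrier G" "\<phi> y \<in> carrier G"
    using yh assms(1) by (auto intro: carrier_of_N carrier_of_H)
  have "n = q \<otimes> (y \<otimes> h)"
    unfolding yh(3) using nc assms(2) by (simp add: m_assoc[symmetric])
  moreover have "h \<otimes> (inv h \<otimes> \<phi> y) = \<phi> y"
    using c by (simp add: m_assoc[symmetric])
  ultimately have "n \<otimes> (inv h \<otimes> \<phi> y) = q \<otimes> (y \<otimes> \<phi> y)"
    using c assms(2) by (simp add: m_assoc)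
  then show ?thesis
    unfolding translated_def y_def h_def .
qed

text \<open>
  Every point of the translated graph over \<open>N\<close> arises because \<open>n \<mapsto> proj_N G N H (inv q \<otimes> n)\<close> is a
  bijection of \<open>N\<close>: it is the action of \<open>inv q\<close> on the coset space \<open>G / H\<close>, of which \<open>N\<close> is a transversal.
\<close>

lemma intrinsic_graph_translated:
  assumes \<phi>: "\<phi> \<in> N \<rightarrow> H" and q: "q \<in> carrier G"
  shows "intrinsic_graph G N (translated G N H \<phi> q) = (\<lambda>x. q \<otimes> x) ` intrinsic_graph G N \<phi>"
proof (intro equalityI subsetI)
  fix z assume "z \<in> intrinsic_graph G N (translated G N H \<phi> q)"
  then obtain n where n: "n \<in> N" "z = n \<otimes> translated G N H \<phi> q n"
    by (auto simp: intrinsic_graph_def)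
  moreover have "proj_N G N H (inv q \<otimes> n) \<in> N"
    using n q by (simp add: proj_closed carrier_of_N)
  ultimately show "z \<in> (\<lambda>x. q \<otimes> x) ` intrinsic_graph G N \<phi>"
    using translated_graph_point[OF \<phi> q] by (auto simp: intrinsic_graph_def)
next
  fix z assume "z \<in> (\<lambda>x. q \<otimes> x) ` intrinsic_graph G N \<phi>"
  then obtain y where y: "y \<in> N" "z = q \<otimes> (y \<otimes> \<phi> y)"
    by (auto simp: intrinsic_graph_def)
  define n h where "n = proj_N G N H (q \<otimes> y)" and "h = proj_H G N H (q \<otimes> y)"
  have yc: "y \<in> carrier G" using y by (simp add: carrier_of_N)
  have nh: "n \<in> N" "h \<in> H" "n \<otimes> h = q \<otimes> y"
    unfolding n_def h_def using q yc by (auto simp: proj_closed proj_N_proj_H)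
  have c: "n \<in> carrier G" "h \<in> carrier G"
    using nh by (auto intro: carrier_of_N carrier_of_H)
  have "inv q \<otimes> n = inv q \<otimes> (n \<otimes> h) \<otimes> inv h"
    using c q by (simp add: m_assoc)
  also have "\<dots> = y \<otimes> inv h"
    unfolding nh(3) using c q yc by (simp add: m_assoc[symmetric])
  finally have "proj_N G N H (inv q \<otimes> n) = y"
    using y nh by (simp add: proj_N_factors)
  then show "z \<in> intrinsic_graph G N (translated G N H \<phi> q)"
    using translated_graph_point[OF \<phi> q nh(1)] y(2) nh(1)
    unfolding intrinsic_graph_def by (intro CollectI exI[of _ n]) simp
qed

end

context metric_group
begin

lemma dist_one_inv_mult:
  assumes "x \<in> carrier G" "y \<in> carrier G"
  shows "d \<one> (inv x \<otimes> y) = d x y"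
  using left_invariant[of "inv x" x y] assms by simp

lemma dist_one_mult:
  assumes "x \<in> carrier G" "y \<in> carrier G"
  shows "d \<one> (x \<otimes> y) \<le> d \<one> x + d \<one> y"
proof -
  have "d x (x \<otimes> y) = d \<one> y"
    using left_invariant[of x \<one> y] assms by simp
  then show ?thesis
    using triangle[of \<one> x "x \<otimes> y"] assms by simp
qed

lemma dist_one_right_factor:
  assumes "x \<in> carrier G" "y \<in> carrier G"
  shows "d \<one> y \<le> d \<one> x + d \<one> (x \<otimes> y)"
proof -
  have "d \<one> y = d x (x \<otimes> y)"
    using left_invariant[of x \<one> y] assms by simp
  also have "\<dots> \<le> d x \<one> + d \<one> (x \<otimes> y)"
    using triangle[of x \<one> "x \<otimes> y"] assms by simp
  finally show ?thesis
    by (simp add: commute)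
qed

text \<open>
  Passing between \<open>\<psi> n\<close> and \<open>n \<otimes> \<psi> n\<close> costs at most \<open>d \<one> n\<close> by the triangle inequality, and the bound is
  linear in \<open>d \<one> n\<close>, so the constant \<open>L + 1\<close> absorbs it in both directions.
\<close>

lemma linear_bound_mult_iff:
  assumes "\<And>n. n \<in> N \<Longrightarrow> n \<in> carrier G" "\<And>n. n \<in> N \<Longrightarrow> \<psi> n \<in> carrier G"
  shows "(\<exists>L>0. \<forall>n\<in>N. d \<one> (\<psi> n) \<le> L * d \<one> n) \<longleftrightarrow> (\<exists>L>0. \<forall>n\<in>N. d \<one> (n \<otimes> \<psi> n) \<le> L * d \<one> n)"
    (is "?A \<longleftrightarrow> ?B")
proof
  assume ?A
  then obtain L where L: "L > 0" "\<And>n. n \<in> N \<Longrightarrow> d \<one> (\<psi> n) \<le> L * d \<one> n" by blast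
  have "d \<one> (n \<otimes> \<psi> n) \<le> (L + 1) * d \<one> n" if "n \<in> N" for n
    using dist_one_mult[of n "\<psi> n"] L(2)[OF that] assms that by (fastforce simp: algebra_simps)
  then show ?B
    using L(1) by (intro exI[of _ "L + 1"]) auto
next
  assume ?B
  then obtain L where L: "L > 0" "\<And>n. n \<in> N \<Longrightarrow> d \<one> (n \<otimes> \<psi> n) \<le> L * d \<one> n" by blast
  have "d \<one> (\<psi> n) \<le> (L + 1) * d \<one> n" if "n \<in> N" for n
    using dist_one_right_factor[of n "\<psi> n"] L(2)[OF that] assms that by (fastforce simp: algebra_simps)
  then show ?A
    using L(1) by (intro exI[of _ "L + 1"]) auto
qed

end

theorem proposition4p2:
  fixes G :: "('a, 'b) monoid_scheme" (structure)
    and T :: "'a topology"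
    and d :: "'a \<Rightarrow> 'a \<Rightarrow> real"
    and N H :: "'a set"
    and \<phi> :: "'a \<Rightarrow> 'a"
    and m p :: 'a
    and k :: real
  assumes "metric_group G T d"
    and "internal_semidirect_product N H G"
    and "\<forall>g \<in> carrier G. d \<one> (proj_N G N H g) \<le> k * d \<one> g"
    and "\<phi> \<in> N \<rightarrow> H"
    and "m \<in> N"
    and "p = m \<otimes> \<phi> m"
  shows "((\<exists>L>0. intrinsically_Lipschitz_at G N H d L \<phi> m) \<longleftrightarrow>
            (\<exists>L>0. \<forall>n\<in>N. d \<one> (translated G N H \<phi> (inv p) n) \<le> L * d \<one> n))
       \<and> ((\<exists>L>0. intrinsically_Lipschitz_at G N H d L \<phi> m) \<longleftrightarrow>
            (\<exists>L>0. \<forall>n\<in>N. d (\<phi> m) (\<phi> n) \<le> L * d \<one> (proj_N G N H (inv p \<otimes> (n \<otimes> \<phi> n)))))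
       \<and> ((\<exists>L>0. intrinsically_Lipschitz_at G N H d L \<phi> m) \<longleftrightarrow>
            (\<exists>L>0. \<forall>n\<in>N. d (\<phi> (proj_N G N H p)) (\<phi> (proj_N G N H (p \<otimes> n))) \<le> L * d \<one> n))
       \<and> ((\<exists>L>0. intrinsically_Lipschitz_at G N H d L \<phi> m) \<longleftrightarrow>
            (\<exists>L>0. \<forall>q \<in> intrinsic_graph G N (translated G N H \<phi> (inv p)).
               d \<one> q \<le> L * d \<one> (proj_N G N H q)))
       \<and> ((\<exists>L>0. intrinsically_Lipschitz_at G N H d L \<phi> m) \<longleftrightarrow>
            (\<exists>L>0. \<forall>q \<in> intrinsic_graph G N \<phi>.
               d p q \<le> L * d \<one> (proj_N G N H (inv p \<otimes> q))))"
proof -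
  interpret metric_group G T d by fact
  interpret internal_semidirect_product N H G by fact
  note \<phi> = \<open>\<phi> \<in> N \<rightarrow> H\<close> and m = \<open>m \<in> N\<close> and p_eq = \<open>p = m \<otimes> \<phi> m\<close>
  define \<psi> where "\<psi> = translated G N H \<phi> (inv p)"
  have \<phi>H: "\<phi> n \<in> H" if "n \<in> N" for n using \<phi> that by blast
  have Nc: "n \<in> carrier G" and \<phi>c: "\<phi> n \<in> carrier G" if "n \<in> N" for n
    using that \<phi>H by (auto intro: carrier_of_N carrier_of_H)
  have pc: "p \<in> carrier G" using m Nc \<phi>c p_eq by simp
  have proj_p: "proj_N G N H p = m" "proj_H G N H p = \<phi> m"
    using m \<phi>H p_eq by (simp_all add: proj_N_factors proj_H_factors)
  have \<psi>H: "\<psi> n \<in> H" if "n \<in> N" for n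
    unfolding \<psi>_def using translated_closed[OF \<phi>] pc that by simp
  have \<psi>c: "\<psi> n \<in> carrier G" if "n \<in> N" for n
    using \<psi>H that by (auto intro: carrier_of_H)
  have graph_\<psi>: "intrinsic_graph G N \<psi> = (\<lambda>x. inv p \<otimes> x) ` intrinsic_graph G N \<phi>"
    unfolding \<psi>_def using intrinsic_graph_translated[OF \<phi>] pc by simp
  have graph_c: "x \<in> carrier G" if "x \<in> intrinsic_graph G N \<phi>" for x
    using that Nc \<phi>c by (auto simp: intrinsic_graph_def)
  have Lipschitz_iff: "intrinsically_Lipschitz_at G N H d L \<phi> m \<longleftrightarrow> (\<forall>n\<in>N. d \<one> (\<psi> n) \<le> L * d \<one> n)" for L
  proof -
    have "intrinsically_Lipschitz_at G N H d L \<phi> m \<longleftrightarrow>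
        (\<forall>z\<in>intrinsic_graph G N \<psi>. d \<one> (proj_H G N H z) \<le> L * d \<one> (proj_N G N H z))"
      unfolding intrinsically_Lipschitz_at_def graph_\<psi> by (simp add: Let_def p_eq)
    also have "\<dots> \<longleftrightarrow> (\<forall>n\<in>N. d \<one> (\<psi> n) \<le> L * d \<one> n)"
      using \<psi>H by (auto simp: intrinsic_graph_def proj_N_factors proj_H_factors)
    finally show ?thesis .
  qed
  have value_dist: "d (\<phi> m) (\<phi> n) = d \<one> (proj_H G N H (inv p \<otimes> (n \<otimes> \<phi> n)))" if "n \<in> N" for n
    using that m pc Nc \<phi>c \<phi>H
    by (simp add: proj_H_mult proj_H_inv proj_p proj_of_N proj_H_of_H dist_one_inv_mult)
  have b: "intrinsically_Lipschitz_at G N H d L \<phi> m \<longleftrightarrow>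
      (\<forall>n\<in>N. d (\<phi> m) (\<phi> n) \<le> L * d \<one> (proj_N G N H (inv p \<otimes> (n \<otimes> \<phi> n))))" for L
    unfolding intrinsically_Lipschitz_at_def
    using value_dist by (auto simp: Let_def p_eq[symmetric] intrinsic_graph_def)
  \<comment> \<open>Right multiplication by \<open>n\<close> does not change the \<open>H\<close>-factor \<open>\<phi> m\<close> of \<open>p\<close>.\<close>
  have \<psi>_dist: "d \<one> (\<psi> n) = d (\<phi> m) (\<phi> (proj_N G N H (p \<otimes> n)))" if "n \<in> N" for n
  proof -
    have "proj_H G N H (p \<otimes> n) = \<phi> m"
      using that m pc Nc \<phi>c by (simp add: proj_H_mult proj_p proj_of_N)
    then show ?thesis
      using that m pc Nc \<phi>c proj_closed(1)[of "p \<otimes> n"]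
      by (simp add: \<psi>_def translated_def dist_one_inv_mult)
  qed
  have d: "(\<forall>q\<in>intrinsic_graph G N \<psi>. d \<one> q \<le> L * d \<one> (proj_N G N H q)) \<longleftrightarrow>
      (\<forall>n\<in>N. d \<one> (n \<otimes> \<psi> n) \<le> L * d \<one> n)" for L
    using \<psi>H by (auto simp: intrinsic_graph_def proj_N_factors)
  have e: "(\<forall>q\<in>intrinsic_graph G N \<phi>. d p q \<le> L * d \<one> (proj_N G N H (inv p \<otimes> q))) \<longleftrightarrow>
      (\<forall>q\<in>intrinsic_graph G N \<psi>. d \<one> q \<le> L * d \<one> (proj_N G N H q))" for L
    unfolding graph_\<psi> using pc graph_c by (auto simp: dist_one_inv_mult)
  show ?thesis
    unfolding \<psi>_def[symmetric] b[symmetric] proj_p(1) e d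
    using linear_bound_mult_iff[of N \<psi>] Nc \<psi>c by (simp add: Lipschitz_iff \<psi>_dist)
qed

end
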